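(* For every integer $n\geq 37$, $f_2(5,n)\leq n+7$. In fact, if $n\geq37$, then (a) $f_2(5,n)\leq n+4$ if $n\equiv1\pmod5$, (b) $f_2(5,n)\leq n+7$ if $n\equiv2\pmod5$, (c) $f_2(5,n)\leq n+7$ if $n\equiv3\pmod5$, (d) $f_2(5,n)\leq n+6$ if $n\equiv4\pmod5$, (e) $f_2(5,n)\leq n+5$ if $n\equiv0\pmod5$.
   Context: Graphs are finite and simple with nonempty vertex set. A clique of a graph is a set of pairwise adjacent vertices (sets with at most one vertex are cliques); a clique is maximal if it is maximal with respect to inclusion, and $c(G)$ is the number of maximal cliques of $G$. For integers $t\geq2$ and $n\geq1$, $f_2(t,n)$ is the minimum of $\sum_{i=1}^t c(G_i)$ over all factorizations of the complete graph $K_n$ into $t$ edge-disjoint spanning subgraphs $G_1,\dots,G_t$ (all on the same $n$ vertices, some possibly edgeless, whose edge sets partition the edge set of $K_n$). *)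

theory Defs
  imports "HOL-Library.Ramsey" "HOL-Library.Disjoint_Sets" "HOL-Number_Theory.Cong"
begin

text \<open>
  A simple graph is given by a vertex set \<open>V\<close> and an edge set \<open>E \<subseteq> [V]\<^bsup>2\<^esup>\<close>.  The constant
  \<^const>\<open>clique\<close> takes the candidate vertex set first and the edge set second.
\<close>

definition maximal_cliques :: "'a set \<Rightarrow> 'a set set \<Rightarrow> 'a set set" where
  "maximal_cliques V E =
     {K. K \<subseteq> V \<and> clique K E \<and> (\<forall>L. L \<subseteq> V \<and> clique L E \<and> K \<subseteq> L \<longrightarrow> L = K)}"

definition num_maximal_cliques :: "'a set \<Rightarrow> 'a set set \<Rightarrow> nat" where
  "num_maximal_cliques V E = card (maximal_cliques V E)"

text \<open>
  The factors are indexed by \<open>0, \<dots>, t - 1\<close>, and \<open>F i\<close> is the edge set of the \<open>i\<close>-th factor.  All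
  factors share the vertex set \<open>V\<close>.  Disjointness is stated for the indexed family rather than
  for its range, so that several factors may be edgeless but no nonempty factor is repeated.
\<close>

definition factorization :: "nat \<Rightarrow> 'a set \<Rightarrow> (nat \<Rightarrow> 'a set set) \<Rightarrow> bool" where
  "factorization t V F \<longleftrightarrow> disjoint_family_on F {..<t} \<and> (\<Union>i<t. F i) = [V]\<^bsup>2\<^esup>"

text \<open>
  The complete graph \<open>K\<^sub>n\<close> is taken on the vertices \<open>0, \<dots>, n - 1\<close>.  The infimum of a set of naturals
  is its minimum as soon as the set is nonempty, which holds here for all \<open>t \<ge> 1\<close>; see the
  lemmas that follow.
\<close>

definition f\<^sub>2 :: "nat \<Rightarrow> nat \<Rightarrow> nat" where
  "f\<^sub>2 t n = Inf {\<Sum>i<t. num_maximal_cliques {..<n} (F i) | F. factorization t {..<n} F}"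

lemma factorization_exists:
  assumes "t \<ge> 1"
  shows "\<exists>F. factorization t V F"
proof
  show "factorization t V (\<lambda>i. if i = 0 then [V]\<^bsup>2\<^esup> else {})"
    using assms by (auto simp: factorization_def disjoint_family_on_def)
qed

lemma f\<^sub>2_attained:
  assumes "t \<ge> 1"
  shows "\<exists>F. factorization t {..<n} F \<and> f\<^sub>2 t n = (\<Sum>i<t. num_maximal_cliques {..<n} (F i))"
proof -
  have "f\<^sub>2 t n \<in> {\<Sum>i<t. num_maximal_cliques {..<n} (F i) | F. factorization t {..<n} F}"
    unfolding f\<^sub>2_def using factorization_exists[OF assms] by (intro Inf_nat_def1) blast
  then show ?thesis by blast
qed

lemma f\<^sub>2_le:
  assumes "factorization t {..<n} F"
  shows "f\<^sub>2 t n \<le> (\<Sum>i<t. num_maximal_cliques {..<n} (F i))"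
  unfolding f\<^sub>2_def using assms by (intro cInf_lower) auto

end

theory Submission
  imports Defs
begin

text \<open>
  An upper bound on \<open>f\<^sub>2\<close> needs one good factorization.  Up to two extra vertices, take five classes
  of \<open>k\<close> vertices, one per colour.  In colour \<open>c\<close> the class \<open>c\<close> is a clique, the core, and the
  other \<open>4k\<close> vertices fall into \<open>k\<close> disjoint cliques, the blocks, such that all vertices of a
  block have the same neighbours in the core.  A maximal clique of this graph is the core or a
  block together with its core neighbours, so five such graphs have at most \<open>5k + 5\<close> maximal cliques.
  A further vertex, joined to class \<open>c\<close> in colour \<open>c\<close>, only enlarges the five cores; so
  \<open>n = 5k + 1\<close> costs \<open>n + 4\<close>.  A second vertex of this kind doubles the core clique in four colours,
  so \<open>n = 5k + 2\<close> costs \<open>n + 7\<close>.  Deleting vertices never raises the number of maximal cliques, and the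
  remaining residues are reached by deleting one, two or three vertices from \<open>5k + 1\<close>
  (\<open>f\<^sub>2_le_of_factorization\<close>).

  What must be shown is that the five graphs can partition the edges between classes; this is the
  notion \<open>frame\<close> below.  For \<open>k = 3\<close> the affine plane of order 4 is an example: delete a point,
  let the lines through it be the classes, and let the blocks of colour \<open>c\<close> be the lines parallel
  to class \<open>c\<close>.  For every odd \<open>k \<ge> 3\<close> a cyclic construction on \<open>\<int>/k\<close>, steered by the pentagon
  on the five colours, works (\<open>frame_odd\<close>).  Two frames can be put on top of each other
  (\<open>frame_add\<close>), and \<open>k = 3 + (k - 3)\<close> gives the even \<open>k \<ge> 6\<close>.
\<close>

section \<open>Maximal cliques and vertex injections\<close>

lemma finite_maximal_cliques: "finite V \<Longrightarrow> finite (maximal_cliques V E)"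
  by (rule finite_subset[of _ "Pow V"]) (auto simp: maximal_cliques_def)

lemma clique_extends_to_maximal:
  assumes "finite V" "K \<subseteq> V" "clique K E"
  shows "\<exists>L\<in>maximal_cliques V E. K \<subseteq> L"
proof -
  let ?S = "{L. L \<subseteq> V \<and> clique L E \<and> K \<subseteq> L}"
  have "finite ?S" "?S \<noteq> {}" using assms by auto
  from finite_has_maximal[OF this] obtain L
    where L: "L \<in> ?S" and max: "\<forall>M\<in>?S. L \<subseteq> M \<longrightarrow> L = M" by (elim bexE)
  have "M = L" if "M \<subseteq> V" "clique M E" "L \<subseteq> M" for M
  proof -
    have "M \<in> ?S" using that L by blast
    with max that(3) show ?thesis by blast
  qed
  with L have "L \<in> maximal_cliques V E" unfolding maximal_cliques_def by simp
  with L show ?thesis by blast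
qed

lemma num_maximal_cliques_le_cover:
  assumes fin: "finite C"
    and mem: "\<And>L. L \<in> C \<Longrightarrow> L \<subseteq> V \<and> clique L E"
    and cover: "\<And>K. K \<subseteq> V \<Longrightarrow> clique K E \<Longrightarrow> \<exists>L\<in>C. K \<subseteq> L"
  shows "num_maximal_cliques V E \<le> card C"
proof -
  have "maximal_cliques V E \<subseteq> C"
  proof
    fix K assume "K \<in> maximal_cliques V E"
    then have K: "K \<subseteq> V" "clique K E"
      and max: "\<And>L. L \<subseteq> V \<Longrightarrow> clique L E \<Longrightarrow> K \<subseteq> L \<Longrightarrow> L = K"
      unfolding maximal_cliques_def by simp_all
    from cover[OF K] obtain L where L: "L \<in> C" "K \<subseteq> L" by (elim bexE)
    have "L = K" using max mem[OF L(1)] L(2) by simp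
    with L(1) show "K \<in> C" by simp
  qed
  with fin show ?thesis unfolding num_maximal_cliques_def by (rule card_mono)
qed

text \<open>
  Taking preimages under \<open>h\<close> maps some of the maximal cliques of the large graph onto those of the
  small one: the image of a maximal clique of the small graph extends to a maximal clique of the
  large graph, whose preimage is again a clique and hence equals the given one.  This covers
  vertex deletion and relabelling at once.
\<close>

lemma num_maximal_cliques_pullback_le:
  assumes fin: "finite V" and inj: "inj_on h U" and sub: "h ` U \<subseteq> V"
  shows "num_maximal_cliques U {e \<in> [U]\<^bsup>2\<^esup>. h ` e \<in> E} \<le> num_maximal_cliques V E"
proof -
  let ?E = "{e \<in> [U]\<^bsup>2\<^esup>. h ` e \<in> E}"
  let ?r = "\<lambda>L. {u \<in> U. h u \<in> L}"
  have pair: "{u, v} \<in> ?E \<longleftrightarrow> {h u, h v} \<in> E" if "u \<in> U" "v \<in> U" "u \<noteq> v" for u v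
    using that by (auto simp: nsets_def)
  have "maximal_cliques U ?E \<subseteq> ?r ` maximal_cliques V E"
  proof
    fix K assume K: "K \<in> maximal_cliques U ?E"
    then have KU: "K \<subseteq> U" and Kc: "clique K ?E"
      and Kmax: "\<And>L. L \<subseteq> U \<Longrightarrow> clique L ?E \<Longrightarrow> K \<subseteq> L \<Longrightarrow> L = K"
      unfolding maximal_cliques_def by simp_all
    have "clique (h ` K) E"
      unfolding clique_def
    proof (intro ballI impI)
      fix a b assume "a \<in> h ` K" "b \<in> h ` K" "a \<noteq> b"
      then obtain u v where uv: "u \<in> K" "v \<in> K" "a = h u" "b = h v" "u \<noteq> v" by auto
      then have "{u, v} \<in> ?E" using Kc unfolding clique_def by blast
      then show "{a, b} \<in> E" using uv by simp
    qed
    moreover have "h ` K \<subseteq> V" using KU sub by blast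
    ultimately obtain L where L: "L \<in> maximal_cliques V E" "h ` K \<subseteq> L"
      using clique_extends_to_maximal[OF fin, of "h ` K" E] by (elim meta_impE bexE)
    have "clique (?r L) ?E"
      unfolding clique_def
    proof (intro ballI impI)
      fix u v assume uv: "u \<in> ?r L" "v \<in> ?r L" "u \<noteq> v"
      then have "h u \<noteq> h v" using inj by (auto dest: inj_onD)
      moreover have "clique L E" using L(1) by (simp add: maximal_cliques_def)
      ultimately have "{h u, h v} \<in> E" using uv unfolding clique_def by simp
      then show "{u, v} \<in> ?E" using pair uv by simp
    qed
    then have "?r L = K" using Kmax[of "?r L"] KU L(2) by blast
    with L(1) show "K \<in> ?r ` maximal_cliques V E" by blast
  qed
  then have "card (maximal_cliques U ?E) \<le> card (?r ` maximal_cliques V E)"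
    by (rule card_mono[OF finite_imageI[OF finite_maximal_cliques[OF fin]]])
  also have "\<dots> \<le> card (maximal_cliques V E)"
    by (rule card_image_le[OF finite_maximal_cliques[OF fin]])
  finally show ?thesis unfolding num_maximal_cliques_def .
qed

lemma f\<^sub>2_le_of_factorization:
  assumes fac: "factorization t V F" and fin: "finite V" and n: "n \<le> card V"
  shows "f\<^sub>2 t n \<le> (\<Sum>i<t. num_maximal_cliques V (F i))"
proof -
  obtain h where inj: "inj_on h {..<n}" and sub: "h ` {..<n} \<subseteq> V"
    using n fin card_le_inj[of "{..<n}" V] by auto
  let ?G = "\<lambda>i. {e \<in> [{..<n}]\<^bsup>2\<^esup>. h ` e \<in> F i}"
  have "h ` e \<in> [V]\<^bsup>2\<^esup>" if "e \<in> [{..<n}]\<^bsup>2\<^esup>" for e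
    using that sub inj_on_subset[OF inj, of e] by (auto simp: nsets_def card_image)
  then have "(\<Union>i<t. ?G i) = [{..<n}]\<^bsup>2\<^esup>"
    using fac unfolding factorization_def by blast
  moreover have "disjoint_family_on ?G {..<t}"
    using fac unfolding factorization_def disjoint_family_on_def by blast
  ultimately have "factorization t {..<n} ?G" unfolding factorization_def by simp
  then have "f\<^sub>2 t n \<le> (\<Sum>i<t. num_maximal_cliques {..<n} (?G i))" by (rule f\<^sub>2_le)
  also have "\<dots> \<le> (\<Sum>i<t. num_maximal_cliques V (F i))"
    by (intro sum_mono num_maximal_cliques_pullback_le fin inj sub)
  finally show ?thesis .
qed

definition edges_of :: "'a set \<Rightarrow> ('a \<Rightarrow> 'a \<Rightarrow> bool) \<Rightarrow> 'a set set" where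
  "edges_of V R = {{u, v} | u v. u \<in> V \<and> v \<in> V \<and> u \<noteq> v \<and> R u v}"

lemma doubleton_in_edges_of:
  assumes "symp R"
  shows "{u, v} \<in> edges_of V R \<longleftrightarrow> u \<in> V \<and> v \<in> V \<and> u \<noteq> v \<and> R u v"
  using sympD[OF assms] unfolding edges_of_def by (auto simp: doubleton_eq_iff)

lemma clique_edges_of:
  assumes "symp R" "K \<subseteq> V"
  shows "clique K (edges_of V R) \<longleftrightarrow> (\<forall>u\<in>K. \<forall>v\<in>K. u \<noteq> v \<longrightarrow> R u v)"
  using assms(2) unfolding clique_def doubleton_in_edges_of[OF assms(1)] by blast

lemma factorization_edges_of:
  assumes sym: "\<And>c. symp (R c)"
    and ex1: "\<And>u v. u \<in> V \<Longrightarrow> v \<in> V \<Longrightarrow> u \<noteq> v \<Longrightarrow> \<exists>!c. c < t \<and> R c u v"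
  shows "factorization t V (\<lambda>c. edges_of V (R c))"
proof -
  have nsets: "e \<in> [V]\<^bsup>2\<^esup> \<longleftrightarrow> (\<exists>u v. e = {u, v} \<and> u \<in> V \<and> v \<in> V \<and> u \<noteq> v)" for e
    by (auto simp: nsets_def card_2_iff)
  have "edges_of V (R c) \<inter> edges_of V (R d) = {}" if "c < t" "d < t" "c \<noteq> d" for c d
  proof (rule ccontr)
    assume "edges_of V (R c) \<inter> edges_of V (R d) \<noteq> {}"
    then obtain u v where uv: "u \<in> V" "v \<in> V" "u \<noteq> v" "R c u v" "{u, v} \<in> edges_of V (R d)"
      unfolding edges_of_def by blast
    then have "R d u v" using doubleton_in_edges_of[OF sym] by blast
    then show False using ex1[OF uv(1-3)] uv(4) that by blast
  qed
  moreover have "(\<Union>c<t. edges_of V (R c)) = [V]\<^bsup>2\<^esup>"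
  proof (intro equalityI subsetI)
    fix e assume "e \<in> (\<Union>c<t. edges_of V (R c))"
    then show "e \<in> [V]\<^bsup>2\<^esup>" unfolding nsets edges_of_def by blast
  next
    fix e assume "e \<in> [V]\<^bsup>2\<^esup>"
    then obtain u v where "e = {u, v}" "u \<in> V" "v \<in> V" "u \<noteq> v" unfolding nsets by blast
    with ex1[of u v] show "e \<in> (\<Union>c<t. edges_of V (R c))" unfolding edges_of_def by blast
  qed
  ultimately show ?thesis unfolding factorization_def disjoint_family_on_def by blast
qed

section \<open>Frames\<close>

text \<open>
  The vertex \<open>(i, x)\<close> is the \<open>x\<close>-th vertex of class \<open>i\<close>.  For \<open>j \<noteq> c\<close> it is in colour \<open>c\<close> that \<open>(j, y)\<close>
  lies in the block numbered \<open>b c j y\<close>, and \<open>P c x s\<close> says that in colour \<open>c\<close> block \<open>s\<close> is joined to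
  the core vertex \<open>(c, x)\<close>.
\<close>

fun frame_edge ::
  "(nat \<Rightarrow> nat \<Rightarrow> nat \<Rightarrow> nat) \<Rightarrow> (nat \<Rightarrow> nat \<Rightarrow> nat \<Rightarrow> bool) \<Rightarrow> nat \<Rightarrow> nat \<times> nat \<Rightarrow> nat \<times> nat \<Rightarrow> bool"
where
  "frame_edge b P c (i, x) (j, y) \<longleftrightarrow>
     (if i = c then j = c \<or> P c x (b c j y)
      else if j = c then P c y (b c i x)
      else b c i x = b c j y)"

text \<open>
  For two vertices of the same class \<open>i\<close>, uniqueness of the colour forces it to be \<open>i\<close>, so they lie in
  different blocks of every other colour: a block meets each class at most once.
\<close>

definition frame ::
  "nat \<Rightarrow> (nat \<Rightarrow> nat \<Rightarrow> nat \<Rightarrow> nat) \<Rightarrow> (nat \<Rightarrow> nat \<Rightarrow> nat \<Rightarrow> bool) \<Rightarrow> bool" where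
  "frame k b P \<longleftrightarrow>
     (\<forall>c j x. x < k \<longrightarrow> b c j x < k) \<and>
     (\<forall>u \<in> {..<5} \<times> {..<k}. \<forall>v \<in> {..<5} \<times> {..<k}. u \<noteq> v \<longrightarrow> (\<exists>!c. c < 5 \<and> frame_edge b P c u v))"

lemma frame_label: "frame k b P \<Longrightarrow> x < k \<Longrightarrow> b c j x < k"
  unfolding frame_def by blast

lemma frame_edge_ex1:
  assumes "frame k b P" "u \<in> {..<5} \<times> {..<k}" "v \<in> {..<5} \<times> {..<k}" "u \<noteq> v"
  shows "\<exists>!c. c < 5 \<and> frame_edge b P c u v"
proof -
  have "\<forall>u \<in> {..<5} \<times> {..<k}. \<forall>v \<in> {..<5} \<times> {..<k}. u \<noteq> v \<longrightarrow> (\<exists>!c. c < 5 \<and> frame_edge b P c u v)"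
    using assms(1) unfolding frame_def by (rule conjunct2)
  from this[THEN bspec, OF assms(2), THEN bspec, OF assms(3)] assms(4) show ?thesis by (rule mp)
qed

lemma frame_edge_sym: "frame_edge b P c u v \<longleftrightarrow> frame_edge b P c v u"
  by (cases u; cases v) auto

text \<open>
  Keep the blocks of both frames apart and join each core vertex of the first frame to all blocks
  of the second, in every colour.  Then an edge between the two parts gets exactly the colour of
  the class of its end in the first part.
\<close>

lemma frame_add:
  assumes 1: "frame k b P" and 2: "frame l b' P'"
  shows "\<exists>b'' P''. frame (k + l) b'' P''"
proof (intro exI)
  let ?b = "\<lambda>c j x. if x < k then b c j x else k + b' c j (x - k)"
  let ?P = "\<lambda>c x s. if x < k then s < k \<longrightarrow> P c x s else s \<ge> k \<and> P' c (x - k) (s - k)"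
  have mixed: "\<exists>!c. c < 5 \<and> frame_edge ?b ?P c (i, x) (j, y)"
    if "i < 5" "j < 5" "x < k" "y \<ge> k" for i x j y
  proof (rule ex1I[of _ i])
    show "i < 5 \<and> frame_edge ?b ?P i (i, x) (j, y)" using that by simp
  next
    fix c assume c: "c < 5 \<and> frame_edge ?b ?P c (i, x) (j, y)"
    have "b c i x < k" using frame_label[OF 1] that by blast
    then show "c = i" using c that by (auto split: if_splits)
  qed
  have "\<exists>!c. c < 5 \<and> frame_edge ?b ?P c (i, x) (j, y)"
    if ij: "i < 5" "j < 5" "x < k + l" "y < k + l" and ne: "(i, x) \<noteq> (j, y)" for i x j y
  proof -
    consider "x < k" "y < k" | "x < k" "y \<ge> k" | "x \<ge> k" "y < k" | "x \<ge> k" "y \<ge> k" by linarith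
    then show ?thesis
    proof cases
      case 1
      have "frame_edge ?b ?P c (i, x) (j, y) = frame_edge b P c (i, x) (j, y)" for c
        using 1 frame_label[OF assms(1)] by auto
      moreover have "\<exists>!c. c < 5 \<and> frame_edge b P c (i, x) (j, y)"
        by (rule frame_edge_ex1[OF assms(1)]) (use ij 1 ne in auto)
      ultimately show ?thesis by presburger
    next
      case 2
      then show ?thesis using mixed ij by blast
    next
      case 3
      then show ?thesis
        unfolding frame_edge_sym[of ?b ?P _ "(i, x)"] using mixed[of j i y x] ij by blast
    next
      case 4
      have "frame_edge ?b ?P c (i, x) (j, y) = frame_edge b' P' c (i, x - k) (j, y - k)" for c
        using 4 by auto
      moreover have "\<exists>!c. c < 5 \<and> frame_edge b' P' c (i, x - k) (j, y - k)"
        by (rule frame_edge_ex1[OF assms(2)]) (use ij 4 ne in auto)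
      ultimately show ?thesis by presburger
    qed
  qed
  moreover have "?b c j x < k + l" if "x < k + l" for c j x
    using that frame_label[OF 1] frame_label[OF 2, of "x - k"] by (auto simp: trans_less_add1)
  ultimately show "frame (k + l) ?b ?P" unfolding frame_def by auto
qed

text \<open>
  The cyclic frame.  The difference set is \<open>D = {2, 4, \<dots>, k - 3} \<subseteq> \<int>/k\<close>.  For odd \<open>k\<close> it has two
  properties: \<open>D \<union> -D = \<int>/k - {-1, 0, 1}\<close> is a disjoint union, and \<open>D + 1 = -D\<close>.  The block label of
  \<open>(j, y)\<close> in colour \<open>c\<close> is \<open>y\<close> or \<open>y + 1\<close>, according to whether \<open>c\<close> and \<open>j\<close> are neighbours on the
  pentagon \<open>0, 1, 2, 3, 4\<close> or not.

  Take \<open>(i, x)\<close> and \<open>(j, y)\<close> with \<open>i \<noteq> j\<close>.  For the three colours \<open>c\<close> other than \<open>i\<close> and \<open>j\<close>,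
  the pentagon gives as label shifts of \<open>(i, j)\<close> one pair with equal entries and the pairs \<open>(0, 1)\<close> and
  \<open>(1, 0)\<close>.  So these colours account for the differences \<open>x - y \<in> {-1, 0, 1}\<close>, each once.  The colours
  \<open>i\<close> and \<open>j\<close> account for \<open>D\<close> and \<open>-D\<close>; if \<open>i\<close> and \<open>j\<close> are not neighbours, the shifts exchange
  these two sets.
\<close>

definition far :: "nat \<Rightarrow> nat \<Rightarrow> bool" where
  "far c j \<longleftrightarrow> j = (c + 2) mod 5 \<or> j = (c + 3) mod 5"

definition cyclic_succ :: "nat \<Rightarrow> nat \<Rightarrow> nat" where
  "cyclic_succ k x = (if Suc x = k then 0 else Suc x)"

definition cyclic_label :: "nat \<Rightarrow> nat \<Rightarrow> nat \<Rightarrow> nat \<Rightarrow> nat" where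
  "cyclic_label k c j x = (if far c j then cyclic_succ k x else x)"

text \<open>
  This says that \<open>x - s\<close> is in \<open>D\<close> modulo \<open>k\<close>: as \<open>k\<close> is odd, a negative difference
  changes its parity when it is reduced.  The exceptions \<open>k - 1\<close> and \<open>1\<close> both exclude the
  residue \<open>-1\<close>.
\<close>

definition cyclic_nbr :: "nat \<Rightarrow> nat \<Rightarrow> nat \<Rightarrow> bool" where
  "cyclic_nbr k x s \<longleftrightarrow>
     s < x \<and> even (x - s) \<and> x - s \<noteq> k - 1 \<or> x < s \<and> odd (s - x) \<and> s - x \<noteq> 1"

lemma cyclic_succ_less: "x < k \<Longrightarrow> cyclic_succ k x < k"
  by (auto simp: cyclic_succ_def)

lemma cyclic_succ_inject:
  assumes "x < k" "y < k"
  shows "cyclic_succ k x = cyclic_succ k y \<longleftrightarrow> x = y"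
  using assms by (auto simp: cyclic_succ_def)

lemma ex1_iff_sum_of_bool:
  assumes "finite A"
  shows "(\<exists>!x. x \<in> A \<and> Q x) \<longleftrightarrow> (\<Sum>x\<in>A. of_bool (Q x)) = (1::nat)"
proof -
  have "(\<Sum>x\<in>A. of_bool (Q x)) = card {x \<in> A. Q x}"
    using assms by (simp add: Int_def)
  moreover have "(\<exists>!x. x \<in> A \<and> Q x) \<longleftrightarrow> (\<exists>x. {x \<in> A. Q x} = {x})"
    unfolding set_eq_iff mem_Collect_eq singleton_iff Ex1_def by metis
  ultimately show ?thesis by (simp add: card_1_singleton_iff)
qed

text \<open>The relation \<open>D + 1 = -D\<close>.\<close>

lemma cyclic_nbr_succ:
  assumes "odd k" "x < k" "y < k"
  shows "cyclic_nbr k x (cyclic_succ k y) \<longleftrightarrow> cyclic_nbr k y x"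
proof (cases "Suc y = k")
  case True
  then have "even y" using assms(1) by auto
  then show ?thesis using True assms(2) by (auto simp: cyclic_nbr_def cyclic_succ_def)
next
  case False
  consider "x \<le> y" | "x = Suc y" | "Suc y < x" by linarith
  then show ?thesis
  proof cases
    case 1
    then have "y - x \<noteq> k - 1" using False assms(3) by linarith
    then show ?thesis using 1 False by (auto simp: cyclic_nbr_def cyclic_succ_def Suc_diff_le)
  next
    case 2
    then show ?thesis using False by (simp add: cyclic_nbr_def cyclic_succ_def)
  next
    case 3
    then have "x - y = Suc (x - Suc y)" by simp
    moreover have "x - Suc y \<noteq> k - 1" using 3 assms(2) by linarith
    ultimately show ?thesis using 3 False by (simp add: cyclic_nbr_def cyclic_succ_def)
  qed
qed

text \<open>The partition of \<open>\<int>/k\<close> into \<open>D\<close>, \<open>-D\<close>, \<open>{0}\<close>, \<open>{-1}\<close> and \<open>{1}\<close>.\<close>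

lemma cyclic_partition:
  assumes "odd k" "k \<ge> 3" "x < k" "y < k"
  shows "of_bool (cyclic_nbr k x y) + of_bool (cyclic_nbr k y x) + of_bool (x = y)
    + of_bool (cyclic_succ k x = y) + of_bool (x = cyclic_succ k y) = (1::nat)"
proof -
  have less: "of_bool (cyclic_nbr k x y) + of_bool (cyclic_nbr k y x)
    + of_bool (cyclic_succ k x = y) + of_bool (x = cyclic_succ k y) = (1::nat)"
    if "x < y" "y < k" for x y
  proof -
    have eqs: "cyclic_succ k x = y \<longleftrightarrow> y - x = 1" "x = cyclic_succ k y \<longleftrightarrow> y - x = k - 1"
      using that by (auto simp: cyclic_succ_def)
    have nbrs: "cyclic_nbr k x y \<longleftrightarrow> odd (y - x) \<and> y - x \<noteq> 1"
      "cyclic_nbr k y x \<longleftrightarrow> even (y - x) \<and> y - x \<noteq> k - 1"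
      using that by (auto simp: cyclic_nbr_def)
    have "even (k - 1)" "k - 1 \<noteq> 1" using assms by auto
    moreover have "of_bool (odd d \<and> d \<noteq> 1) + of_bool (even d \<and> d \<noteq> e) + of_bool (d = 1)
      + of_bool (d = e) = (1::nat)" if "even e" "e \<noteq> 1" for d e :: nat
      using that by auto
    ultimately show ?thesis unfolding eqs nbrs by blast
  qed
  consider "x < y" | "x = y" | "y < x" by linarith
  then show ?thesis
  proof cases
    case 1
    then show ?thesis using less[of x y] assms by simp
  next
    case 2
    then show ?thesis using assms by (auto simp: cyclic_nbr_def cyclic_succ_def)
  next
    case 3
    then show ?thesis using less[of y x] assms by (simp add: eq_commute[of y]
        eq_commute[of "cyclic_succ k y"] add_ac)
  qed
qed

lemma frame_odd:
  assumes k: "odd k" "k \<ge> 3"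
  shows "frame k (cyclic_label k) (\<lambda>c. cyclic_nbr k)"
proof -
  have "\<exists>!c. c < 5 \<and> frame_edge (cyclic_label k) (\<lambda>c. cyclic_nbr k) c (i, x) (j, y)"
    if ij: "i < 5" "j < 5" and xy: "x < k" "y < k" and ne: "(i, x) \<noteq> (j, y)" for i x j y
  proof (cases "i = j")
    case True
    then show ?thesis using ne ij cyclic_succ_inject[OF xy]
      by (intro ex1I[of _ i]) (auto simp: cyclic_label_def split: if_splits)
  next
    case False
    have "i \<in> {0, 1, 2, 3, 4}" "j \<in> {0, 1, 2, 3, 4}" using ij by auto
    have sum5: "(\<Sum>c<5. f c) = f 0 + f 1 + f 2 + f 3 + f 4" for f :: "nat \<Rightarrow> nat"
      by (simp add: eval_nat_numeral)
    have "far 0 j \<longleftrightarrow> j = 2 \<or> j = 3" "far 1 j \<longleftrightarrow> j = 3 \<or> j = 4" "far 2 j \<longleftrightarrow> j = 4 \<or> j = 0"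
      "far 3 j \<longleftrightarrow> j = 0 \<or> j = 1" "far 4 j \<longleftrightarrow> j = 1 \<or> j = 2" for j
      by (auto simp: far_def)
    (* The simplifier writes the colour 1 as Suc 0. *)
    note far = this this[unfolded One_nat_def]
    note orient = eq_commute[of y x] eq_commute[of y "cyclic_succ k x"]
      eq_commute[of "cyclic_succ k y" x] eq_commute[of "cyclic_succ k y" "cyclic_succ k x"]
    (* In each of the twenty cases the five summands are a rearrangement of those in
       cyclic_partition, once equations are oriented as there. *)
    have "(\<Sum>c<5. of_bool (frame_edge (cyclic_label k) (\<lambda>c. cyclic_nbr k) c (i, x) (j, y))) = (1::nat)"
      using \<open>i \<in> _\<close> \<open>j \<in> _\<close> False cyclic_partition[OF k xy] unfolding sum5
      by (elim insertE emptyE)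
        (simp_all add: cyclic_label_def far orient cyclic_succ_inject[OF xy]
            cyclic_nbr_succ[OF k(1) xy] cyclic_nbr_succ[OF k(1) xy(2,1)] del: of_bool_eq_iff)
    then show ?thesis
      unfolding ex1_iff_sum_of_bool[OF finite_lessThan, symmetric] lessThan_iff .
  qed
  then show ?thesis unfolding frame_def
    by (auto simp: cyclic_label_def cyclic_succ_less simp del: frame_edge.simps)
qed

lemma frame_exists:
  assumes "k \<ge> 5"
  shows "\<exists>b P. frame k b P"
proof (cases "odd k")
  case True
  moreover have "k \<ge> 3" using assms by simp
  ultimately show ?thesis using frame_odd by blast
next
  case False
  then have "odd (k - 3)" "k - 3 \<ge> 3" using assms by presburger+
  then have "frame (k - 3) (cyclic_label (k - 3)) (\<lambda>c. cyclic_nbr (k - 3))" by (rule frame_odd)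
  moreover have "frame 3 (cyclic_label 3) (\<lambda>c. cyclic_nbr 3)" by (rule frame_odd) auto
  ultimately show ?thesis using frame_add[of 3 _ _ "k - 3"] assms by fastforce
qed

section \<open>Adding apices and counting cliques\<close>

text \<open>
  An apex \<open>Inr w\<close> is joined to class \<open>c\<close> in colour \<open>c\<close>.  All edges between apices get colour 0, so
  that in colour 0 the core and the apices form a single clique.
\<close>

fun apex_edge ::
  "(nat \<Rightarrow> nat \<Rightarrow> nat \<Rightarrow> nat) \<Rightarrow> (nat \<Rightarrow> nat \<Rightarrow> nat \<Rightarrow> bool) \<Rightarrow> nat \<Rightarrow>
     nat \<times> nat + nat \<Rightarrow> nat \<times> nat + nat \<Rightarrow> bool"
where
  "apex_edge b P c (Inl u) (Inl v) \<longleftrightarrow> frame_edge b P c u v"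
| "apex_edge b P c (Inl (i, x)) (Inr w) \<longleftrightarrow> i = c"
| "apex_edge b P c (Inr w) (Inl (j, y)) \<longleftrightarrow> j = c"
| "apex_edge b P c (Inr w) (Inr w') \<longleftrightarrow> c = 0"

lemma symp_apex_edge: "symp (apex_edge b P c)"
proof (rule sympI)
  fix u v assume "apex_edge b P c u v"
  then show "apex_edge b P c v u"
    by (cases u; cases v) (auto simp: frame_edge_sym simp del: frame_edge.simps)
qed

definition apex_vertices :: "nat \<Rightarrow> nat \<Rightarrow> (nat \<times> nat + nat) set" where
  "apex_vertices k a = ({..<5} \<times> {..<k}) <+> {..<a}"

lemma apex_factorization:
  assumes "frame k b P"
  shows "factorization 5 (apex_vertices k a) (\<lambda>c. edges_of (apex_vertices k a) (apex_edge b P c))"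
proof (rule factorization_edges_of[OF symp_apex_edge])
  fix u v assume uv: "u \<in> apex_vertices k a" "v \<in> apex_vertices k a" "u \<noteq> v"
  show "\<exists>!c. c < 5 \<and> apex_edge b P c u v"
  proof (cases u; cases v)
    fix p q assume "u = Inl p" "v = Inl q"
    with uv have "p \<in> {..<5} \<times> {..<k}" "q \<in> {..<5} \<times> {..<k}" "p \<noteq> q"
      by (auto simp: apex_vertices_def)
    then have "\<exists>!c. c < 5 \<and> frame_edge b P c p q"
      by (rule frame_edge_ex1[OF assms])
    then show ?thesis using \<open>u = Inl p\<close> \<open>v = Inl q\<close> by simp
  qed (use uv in \<open>auto simp: apex_vertices_def\<close>)
qed

text \<open>
  A clique of colour \<open>c\<close> that contains a vertex of another class lies within that vertex's block and
  the core neighbours of the block.  Any other clique lies within the core and the apices, which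
  form one clique for \<open>c = 0\<close>; for \<open>c \<noteq> 0\<close> the apices are pairwise nonadjacent, so at most one of
  them is in the clique.
\<close>

lemma apex_num_maximal_cliques:
  assumes fr: "frame k b P" and c: "c < 5" and a: "a \<ge> 1"
  shows "num_maximal_cliques (apex_vertices k a) (edges_of (apex_vertices k a) (apex_edge b P c))
    \<le> k + (if c = 0 then 1 else a)"
proof -
  let ?V = "apex_vertices k a" and ?R = "apex_edge b P c"
  let ?E = "edges_of ?V ?R"
  define core :: "(nat \<times> nat + nat) set" where "core = {Inl (c, x) | x. x < k}"
  define blk :: "nat \<Rightarrow> (nat \<times> nat + nat) set" where
    "blk s = {Inl (j, y) | j y. j < 5 \<and> y < k \<and> j \<noteq> c \<and> b c j y = s}
       \<union> {Inl (c, x) | x. x < k \<and> P c x s}" for s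
  define tops :: "(nat \<times> nat + nat) set set" where
    "tops = (if c = 0 then {core \<union> Inr ` {..<a}} else (\<lambda>w. insert (Inr w) core) ` {..<a})"
  note cl = clique_edges_of[OF symp_apex_edge]
  have "num_maximal_cliques ?V ?E \<le> card (blk ` {..<k} \<union> tops)"
  proof (rule num_maximal_cliques_le_cover)
    show "finite (blk ` {..<k} \<union> tops)" unfolding tops_def by auto
  next
    fix L assume "L \<in> blk ` {..<k} \<union> tops"
    then consider s where "L = blk s" | "L \<in> tops" by blast
    then show "L \<subseteq> ?V \<and> clique L ?E"
    proof cases
      case 1
      then have "L \<subseteq> ?V" using c by (auto simp: blk_def apex_vertices_def)
      moreover have "\<forall>u\<in>L. \<forall>v\<in>L. u \<noteq> v \<longrightarrow> ?R u v" using 1 by (auto simp: blk_def)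
      ultimately show ?thesis using cl by blast
    next
      case 2
      then have "L \<subseteq> ?V" using c by (auto simp: tops_def core_def apex_vertices_def split: if_splits)
      moreover have "\<forall>u\<in>L. \<forall>v\<in>L. u \<noteq> v \<longrightarrow> ?R u v"
        using 2 by (auto simp: tops_def core_def split: if_splits)
      ultimately show ?thesis using cl by blast
    qed
  next
    fix K assume KV: "K \<subseteq> ?V" and "clique K ?E"
    then have adj: "\<And>u v. u \<in> K \<Longrightarrow> v \<in> K \<Longrightarrow> u \<noteq> v \<Longrightarrow> ?R u v" using cl by blast
    show "\<exists>L\<in>blk ` {..<k} \<union> tops. K \<subseteq> L"
    proof (cases "\<exists>j y. Inl (j, y) \<in> K \<and> j \<noteq> c")
      case True
      then obtain j y where jy: "Inl (j, y) \<in> K" "j \<noteq> c" by blast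
      then have y: "y < k" using KV by (auto simp: apex_vertices_def)
      have "K \<subseteq> blk (b c j y)"
      proof
        fix u assume u: "u \<in> K"
        then have "u = Inl (j, y) \<or> ?R u (Inl (j, y))" using adj jy(1) by blast
        then show "u \<in> blk (b c j y)"
          using subsetD[OF KV u] subsetD[OF KV jy(1)] jy(2)
          by (cases u) (auto simp: apex_vertices_def blk_def split: if_splits)
      qed
      then show ?thesis using frame_label[OF fr y] by blast
    next
      case False
      then have K: "K \<subseteq> core \<union> Inr ` {..<a}"
      proof (intro subsetI)
        fix u assume u: "u \<in> K"
        with False subsetD[OF KV u] show "u \<in> core \<union> Inr ` {..<a}"
          by (cases u) (auto simp: apex_vertices_def core_def)
      qed
      have "\<exists>L\<in>tops. K \<subseteq> L"
      proof (cases "c = 0")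
        case True
        then show ?thesis using K by (simp add: tops_def)
      next
        case c0: False
        show ?thesis
        proof (cases "\<exists>w. Inr w \<in> K")
          case True
          then obtain w where w: "Inr w \<in> K" by blast
          have "w' = w" if "Inr w' \<in> K" for w'
            using adj[OF that w] c0 by auto
          then have "K \<subseteq> insert (Inr w) core" using K by blast
          moreover have "w < a" using w K by (auto simp: core_def)
          ultimately show ?thesis using c0 by (auto simp: tops_def)
        next
          case False
          then have "K \<subseteq> insert (Inr 0) core" using K by blast
          then show ?thesis using c0 a by (auto simp: tops_def)
        qed
      qed
      then show ?thesis by blast
    qed
  qed
  also have "\<dots> \<le> card (blk ` {..<k}) + card tops" by (rule card_Un_le)
  also have "\<dots> \<le> k + (if c = 0 then 1 else a)"
    using card_image_le[of "{..<k}" blk]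
      card_image_le[of "{..<a}" "\<lambda>w. insert (Inr w) core"]
    by (intro add_mono) (auto simp: tops_def)
  finally show ?thesis .
qed

lemma f\<^sub>2_5_le_apices:
  assumes k: "k \<ge> 5" and a: "a \<ge> 1" and n: "n \<le> 5 * k + a"
  shows "f\<^sub>2 5 n \<le> 5 * k + 1 + 4 * a"
proof -
  obtain b P where fr: "frame k b P" using frame_exists[OF k] by blast
  let ?V = "apex_vertices k a"
  have "finite ?V" "card ?V = 5 * k + a"
    unfolding apex_vertices_def by (auto simp: card_Plus)
  then have "f\<^sub>2 5 n \<le> (\<Sum>c<5. num_maximal_cliques ?V (edges_of ?V (apex_edge b P c)))"
    using n by (intro f\<^sub>2_le_of_factorization apex_factorization fr) auto
  also have "\<dots> \<le> (\<Sum>c<5::nat. k + (if c = 0 then 1 else a))"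
    by (intro sum_mono apex_num_maximal_cliques fr a) auto
  also have "\<dots> = 5 * k + 1 + 4 * a"
    by (simp add: eval_nat_numeral)
  finally show ?thesis .
qed

theorem theorem27:
  fixes n :: nat
  assumes "n \<ge> 37"
  shows "f\<^sub>2 5 n \<le> n + 7 \<and>
    ([n = 1] (mod 5) \<longrightarrow> f\<^sub>2 5 n \<le> n + 4) \<and>
    ([n = 2] (mod 5) \<longrightarrow> f\<^sub>2 5 n \<le> n + 7) \<and>
    ([n = 3] (mod 5) \<longrightarrow> f\<^sub>2 5 n \<le> n + 7) \<and>
    ([n = 4] (mod 5) \<longrightarrow> f\<^sub>2 5 n \<le> n + 6) \<and>
    ([n = 0] (mod 5) \<longrightarrow> f\<^sub>2 5 n \<le> n + 5)"
proof -
  have one: "f\<^sub>2 5 n \<le> 5 * k + 5" if "k \<ge> 5" "n \<le> 5 * k + 1" for k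
    using f\<^sub>2_5_le_apices[of k 1 n] that by simp
  have two: "f\<^sub>2 5 n \<le> 5 * k + 9" if "k \<ge> 5" "n \<le> 5 * k + 2" for k
    using f\<^sub>2_5_le_apices[of k 2 n] that by simp
  (* Residues 0 and 1 use n div 5 vertices per class, residues 3 and 4 one more, all with one apex;
     residue 2 is cheaper with a second apex than with larger classes. *)
  have n: "n = 5 * (n div 5) + n mod 5" and d: "n div 5 \<ge> 5" using assms by auto
  have "n mod 5 \<in> {0, 1, 2, 3, 4}" by auto
  then consider "n mod 5 = 0" | "n mod 5 = 1" | "n mod 5 = 2" | "n mod 5 = 3" | "n mod 5 = 4"
    by (elim insertE emptyE) simp_all
  then show ?thesis
  proof cases
    case 1
    have "f\<^sub>2 5 n \<le> n + 5" using one[of "n div 5"] d n 1 by linarith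
    then show ?thesis using 1 by (simp add: cong_def)
  next
    case 2
    have "f\<^sub>2 5 n \<le> n + 4" using one[of "n div 5"] d n 2 by linarith
    then show ?thesis using 2 by (simp add: cong_def)
  next
    case 3
    have "f\<^sub>2 5 n \<le> n + 7" using two[of "n div 5"] d n 3 by linarith
    then show ?thesis using 3 by (simp add: cong_def)
  next
    case 4
    have "f\<^sub>2 5 n \<le> n + 7" using one[of "n div 5 + 1"] d n 4 by simp
    then show ?thesis using 4 by (simp add: cong_def)
  next
    case 5
    have "f\<^sub>2 5 n \<le> n + 6" using one[of "n div 5 + 1"] d n 5 by simp
    then show ?thesis using 5 by (simp add: cong_def)
  qed
qed

end
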